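(* Let $k\ge1$. Then (i) $[\![\alpha]\!]<\boldsymbol\omega^{k}$ for every $\alpha\in\Psi_k$; and (ii) for every set-theoretic ordinal $\boldsymbol\alpha<\boldsymbol\omega^{k}$ there is $\alpha\in\Psi_k$ with $[\![\alpha]\!]=\boldsymbol\alpha$.
   Context: Constructive ordinals: $\Omega$ is the set of infinitary terms generated by $0$, successor $\alpha+1$, and limits $\langle\alpha_i\rangle_{i\in\mathbb{N}}$. $o(0)=0$, $o(n+1)=o(n)+1$, $\omega=\langle o(i+1)\rangle_i$. Arithmetic: $\alpha+0=\alpha$, $\alpha+(\beta+1)=(\alpha+\beta)+1$, $\alpha+\langle\beta_i\rangle=\langle\alpha+\beta_i\rangle$; $\alpha\cdot0=0$, $\alpha\cdot(\beta+1)=\alpha\cdot\beta+\alpha$, $\alpha\cdot\langle\beta_i\rangle=\langle\alpha\cdot\beta_i\rangle$; $\alpha^0=o(1)$, $\alpha^{\beta+1}=\alpha^\beta\cdot\alpha$, $\alpha^{\langle\beta_i\rangle}=\langle\alpha^{\beta_i}\rangle$. $\Psi_k$ is the closure of $\{0\}\cup\{\omega^{o(p)}:p<k\}$ under $+$. $[\![-]\!]:\Omega\to\mathbf{On}$: $[\![0]\!]=\mathbf0$, $[\![\alpha+1]\!]=[\![\alpha]\!]+\mathbf1$, $[\![\langle\alpha_i\rangle]\!]=\bigcup_i[\![\alpha_i]\!]$; $\boldsymbol\omega$ is the least infinite set-theoretic ordinal. *)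

theory Defs
  imports Main "HOL-Library.Infinite_Typeclass"
begin

section \<open>Constructive ordinals\<close>

datatype cord = Zero | Succ cord | Lim "nat \<Rightarrow> cord"

primrec fin_cord :: "nat \<Rightarrow> cord" where
  "fin_cord 0 = Zero"
| "fin_cord (Suc n) = Succ (fin_cord n)"

definition omega_cord :: cord where
  "omega_cord = Lim (\<lambda>i. fin_cord (i + 1))"

primrec cadd :: "cord \<Rightarrow> cord \<Rightarrow> cord" where
  "cadd a Zero = a"
| "cadd a (Succ b) = Succ (cadd a b)"
| "cadd a (Lim f) = Lim (\<lambda>i. cadd a (f i))"

primrec cmul :: "cord \<Rightarrow> cord \<Rightarrow> cord" where
  "cmul a Zero = Zero"
| "cmul a (Succ b) = cadd (cmul a b) a"
| "cmul a (Lim f) = Lim (\<lambda>i. cmul a (f i))"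

primrec cpow :: "cord \<Rightarrow> cord \<Rightarrow> cord" where
  "cpow a Zero = fin_cord 1"
| "cpow a (Succ b) = cmul (cpow a b) a"
| "cpow a (Lim f) = Lim (\<lambda>i. cpow a (f i))"

inductive_set Psi :: "nat \<Rightarrow> cord set" for k :: nat where
  zero: "Zero \<in> Psi k"
| power: "p < k \<Longrightarrow> cpow omega_cord (fin_cord p) \<in> Psi k"
| add: "a \<in> Psi k \<Longrightarrow> b \<in> Psi k \<Longrightarrow> cadd a b \<in> Psi k"


section \<open>Set-theoretic ordinals\<close>

text \<open>
  The elements of \<open>'a ordinal\<close> are the isomorphism classes of well-orders on subsets of \<open>'a\<close>.
  This is the initial segment of the class of all ordinals consisting of the ordinals of
  cardinality at most that of \<open>'a\<close>. For infinite \<open>'a\<close> it has no largest element and is closed under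
  suprema of at most \<open>|'a|\<close> many elements (\<open>small_strictly_bounded\<close> below), in particular
  under countable ones.
\<close>

quotient_type 'a ordinal = "'a rel" / partial: "\<lambda>r s. (r, s) \<in> ordIso"
proof (rule part_equivpI)
  have "Well_order ({} :: 'a rel)" by simp
  then show "\<exists>r :: 'a rel. (r, r) \<in> ordIso" using ordIso_reflexive by blast
  show "symp (\<lambda>r s :: 'a rel. (r, s) \<in> ordIso)" by (simp add: ordIso_symmetric sympI)
  show "transp (\<lambda>r s :: 'a rel. (r, s) \<in> ordIso)"
    by (meson ordIso_transitive transpI)
qed

lemma ordIso_self_iff: "(r, r) \<in> ordIso \<longleftrightarrow> Well_order r"
  using ordIso_reflexive by (auto simp: ordIso_def)

instantiation ordinal :: (type) linorder
begin

lift_definition less_eq_ordinal :: "'a ordinal \<Rightarrow> 'a ordinal \<Rightarrow> bool"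
  is "\<lambda>r s. (r, s) \<in> ordLeq"
  by (meson ordIso_ordLeq_trans ordIso_symmetric ordLeq_ordIso_trans)

lift_definition less_ordinal :: "'a ordinal \<Rightarrow> 'a ordinal \<Rightarrow> bool"
  is "\<lambda>r s. (r, s) \<in> ordLess"
  by (meson ordIso_ordLess_trans ordIso_symmetric ordLess_ordIso_trans)

instance
proof
  fix x y z :: "'a ordinal"
  show "x < y \<longleftrightarrow> x \<le> y \<and> \<not> y \<le> x"
    by transfer (metis not_ordLess_iff_ordLeq ordIso_self_iff ordLess_imp_ordLeq
        not_ordLess_ordLeq)
  show "x \<le> x" by transfer (simp add: ordIso_iff_ordLeq)
  show "x \<le> y \<Longrightarrow> y \<le> z \<Longrightarrow> x \<le> z" by transfer (rule ordLeq_transitive)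
  show "x \<le> y \<Longrightarrow> y \<le> x \<Longrightarrow> x = y" by transfer (simp add: ordIso_iff_ordLeq)
  show "x \<le> y \<or> y \<le> x" by transfer (simp add: ordIso_self_iff ordLeq_total)
qed

end

instance ordinal :: (type) wellorder
proof (rule wf_wellorderI)
  show "wf {(x, y :: 'a ordinal). x < y}"
  proof (rule wf_subset)
    show "wf (inv_image ordLess (rep_ordinal :: 'a ordinal \<Rightarrow> 'a rel))"
      by (rule wf_inv_image[OF wf_ordLess])
    show "{(x, y :: 'a ordinal). x < y} \<subseteq> inv_image ordLess rep_ordinal"
      by (auto simp: less_ordinal_def)
  qed
qed intro_classes

definition osuc :: "'a ordinal \<Rightarrow> 'a ordinal" where
  "osuc x = (LEAST y. x < y)"

definition osup :: "'a ordinal set \<Rightarrow> 'a ordinal" where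
  "osup S = (LEAST u. \<forall>x\<in>S. x \<le> u)"

instantiation ordinal :: (type) "{zero, one}"
begin

lift_definition zero_ordinal :: "'a ordinal" is "{}"
  by (simp add: ordIso_self_iff)

definition one_ordinal :: "'a ordinal" where
  "one_ordinal = osuc 0"

instance ..

end

text \<open>Transfinite recursion with value \<open>z\<close> at zero, \<open>s\<close> at successors and suprema at limits.\<close>

function orec :: "'a ordinal \<Rightarrow> ('a ordinal \<Rightarrow> 'a ordinal) \<Rightarrow> 'a ordinal \<Rightarrow> 'a ordinal" where
  "orec z s b =
     (if b = 0 then z
      else if \<exists>c<b. b = osuc c then s (orec z s (SOME c. c < b \<and> b = osuc c))
      else osup ((\<lambda>c. orec z s c) ` {c. c < b}))"
  by pat_completeness auto
termination
proof (relation "inv_image {(x, y :: 'a ordinal). x < y} (\<lambda>(z, s, b). b)", goal_cases)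
  case 1
  show ?case by (rule wf_inv_image) (rule wf)
next
  case (2 z s b)
  then have "(SOME c. c < b \<and> b = osuc c) < b"
    using someI_ex[of "\<lambda>c. c < b \<and> b = osuc c"] by blast
  then show ?case by simp
qed simp

declare orec.simps [simp del]

instantiation ordinal :: (type) "{plus, times}"
begin

definition plus_ordinal :: "'a ordinal \<Rightarrow> 'a ordinal \<Rightarrow> 'a ordinal" where
  "a + b = orec a osuc b"

definition times_ordinal :: "'a ordinal \<Rightarrow> 'a ordinal \<Rightarrow> 'a ordinal" where
  "a * b = orec 0 (\<lambda>x. x + a) b"

instance ..

end

definition opow :: "'a ordinal \<Rightarrow> 'a ordinal \<Rightarrow> 'a ordinal" (infixr "^o" 80) where
  "a ^o b = orec 1 (\<lambda>x. x * a) b"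

primrec fin_ord :: "nat \<Rightarrow> 'a ordinal" where
  "fin_ord 0 = 0"
| "fin_ord (Suc n) = fin_ord n + 1"

text \<open>Identifying an ordinal with the set of smaller ordinals, \<open>x\<close> is infinite iff \<open>{..<x}\<close> is.\<close>

definition omega_ord :: "'a ordinal" where
  "omega_ord = (LEAST x. infinite {..<x})"


section \<open>Interpretation of constructive ordinals\<close>

text \<open>
  The union of a set of von Neumann ordinals is its supremum. The supremum below exists since
  countable subsets of \<open>'a ordinal\<close> are bounded for infinite \<open>'a\<close>.
\<close>

primrec sem :: "cord \<Rightarrow> 'a::infinite ordinal" where
  "sem Zero = 0"
| "sem (Succ a) = sem a + 1"
| "sem (Lim f) = osup (range (\<lambda>i. sem (f i)))"


section \<open>Basic properties of the ordinals\<close>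

lemma ordinal_zero_le [simp]: "(0 :: 'a ordinal) \<le> x"
proof transfer
  fix r :: "'a rel"
  assume "(r, r) \<in> ordIso"
  then have "Well_order r" by (simp add: ordIso_self_iff)
  then show "({}, r) \<in> ordLeq"
    by (simp add: ordLeq_iff_ordLess_Restr)
qed

lemma card_of_lessThan_ordinal:
  fixes x :: "'a ordinal"
  shows "(card_of {..<x}, card_of (UNIV :: 'a set)) \<in> ordLeq"
proof -
  define r where "r = rep_ordinal x"
  have r: "(r, r) \<in> ordIso"
    unfolding r_def using Quotient_rep_reflp[OF Quotient_ordinal] by auto
  have "{..<x} \<subseteq> (\<lambda>a. abs_ordinal (Restr r (underS r a))) ` UNIV"
  proof
    fix y assume "y \<in> {..<x}"
    then have y: "y < x" by simp
    define t where "t = rep_ordinal y"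
    have t: "(t, t) \<in> ordIso" and y': "y = abs_ordinal t"
      unfolding t_def by (rule Quotient_rep_reflp[OF Quotient_ordinal],
          rule Quotient_abs_rep[OF Quotient_ordinal, symmetric])
    have "(t, r) \<in> ordLess" using y by (simp add: less_ordinal_def r_def t_def)
    then obtain a where "(t, Restr r (underS r a)) \<in> ordIso"
      using ordLess_iff_ordIso_Restr r t by (auto simp: ordIso_self_iff)
    then have "y = abs_ordinal (Restr r (underS r a))"
      unfolding y' using Quotient_rel_abs[OF Quotient_ordinal] by blast
    then show "y \<in> (\<lambda>a. abs_ordinal (Restr r (underS r a))) ` UNIV" by blast
  qed
  then have "(card_of {..<x}, card_of ((\<lambda>a. abs_ordinal (Restr r (underS r a))) ` UNIV)) \<in> ordLeq"
    by (rule card_of_mono1)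
  then show ?thesis using card_of_image ordLeq_transitive by blast
qed

lemma no_inj_ordinal: "\<not> inj (f :: 'a ordinal \<Rightarrow> 'a)"
proof
  assume f: "inj f"
  define R :: "'a ordinal rel" where "R = {(x, y). x \<le> y}"
  have FR: "Field R = UNIV" unfolding R_def Field_def by auto
  have R_Id: "R - Id = {(x, y). x < y}" unfolding R_def by auto
  have R: "Well_order R"
    unfolding well_order_on_def linear_order_on_def partial_order_on_def preorder_on_def FR R_Id
    by (auto simp: R_def refl_on_def trans_def antisym_def total_on_def intro: wf)
  define r where "r = dir_image R f"
  have r: "Well_order r"
    unfolding r_def using R f by (auto intro!: Well_order_dir_image simp: FR)
  define g where "g x = abs_ordinal (Restr r (underS r (f x)))" for x
  have in_r: "(f x, f y) \<in> r \<longleftrightarrow> x \<le> y" for x y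
    unfolding r_def dir_image_def R_def using f by (auto dest: injD)
  have ran: "a \<in> range f" if "(a, b) \<in> r" for a b
    using that unfolding r_def dir_image_def by auto
  have und: "underS r (f x) = f ` {..<x}" for x
  proof (intro equalityI subsetI)
    fix a assume "a \<in> underS r (f x)"
    then have "a \<noteq> f x" and ar: "(a, f x) \<in> r" by (auto simp: underS_def)
    moreover from ran[OF ar] obtain y where "a = f y" by blast
    ultimately show "a \<in> f ` {..<x}" using in_r by (auto simp: less_le)
  next
    fix a assume "a \<in> f ` {..<x}"
    then show "a \<in> underS r (f x)"
      using f by (auto simp: underS_def in_r dest: injD)
  qed
  have of: "wo_rel.ofilter r (underS r a)" for a
    using r by (simp add: wo_rel_def wo_rel.underS_ofilter)
  have RW: "Well_order (Restr r A)" for A using r by (rule Well_order_Restr)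
  have less: "abs_ordinal u < abs_ordinal v \<longleftrightarrow> (u, v) \<in> ordLess"
    if "Well_order u" "Well_order v" for u v :: "'a rel"
    using that by (simp add: less_ordinal.abs_eq ordIso_self_iff)
  have mono: "g x < g y" if "x < y" for x y
  proof -
    have "underS r (f x) \<subset> underS r (f y)"
      unfolding und using that f by (auto simp: inj_image_subset_iff psubset_eq inj_image_eq_iff)
    then show ?thesis
      unfolding g_def less[OF RW RW] using ofilter_subset_ordLess[OF r of of] by blast
  qed
  have ge: "x \<le> g x" for x
  proof (induction x rule: less_induct)
    case (less x)
    show ?case
    proof (rule ccontr)
      assume "\<not> x \<le> g x"
      then have "g x < x" by simp
      with less have "g x \<le> g (g x)" and "g (g x) < g x" using mono by blast+
      then show False by simp
    qed
  qed
  have "Field r \<noteq> {}" using in_r[of 0 0] by (auto simp: Field_def)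
  then have "g x < abs_ordinal r" for x
    unfolding g_def less[OF RW r] using underS_Restr_ordLess[OF r] by blast
  with ge show False using leD by blast
qed

lemma small_strictly_bounded:
  fixes S :: "'a::infinite ordinal set"
  assumes "(card_of S, card_of (UNIV :: 'a set)) \<in> ordLeq"
  shows "\<exists>u. \<forall>x\<in>S. x < u"
proof (rule ccontr)
  assume "\<not> ?thesis"
  then have unb: "\<exists>x\<in>S. u \<le> x" for u by (meson not_le)
  have inf: "infinite (UNIV :: 'a set)" by (rule infinite_UNIV)
  have "(card_of (\<Union>x\<in>S. {..<x}), card_of (UNIV :: 'a set)) \<in> ordLeq"
    using inf assms card_of_lessThan_ordinal by (intro card_of_UNION_ordLeq_infinite) auto
  then have "(card_of ((\<Union>x\<in>S. {..<x}) \<union> S), card_of (UNIV :: 'a set)) \<in> ordLeq"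
    using inf assms card_of_Card_order[of "UNIV :: 'a set"] card_of_Un_ordLeq_infinite_Field
    unfolding Field_card_of by (metis Field_card_of)
  moreover have "(\<Union>x\<in>S. {..<x}) \<union> S = UNIV"
    using unb by (auto simp: le_less)
  ultimately show False
    using no_inj_ordinal card_of_ordLeq[of "UNIV :: 'a ordinal set" "UNIV :: 'a set"] by auto
qed

lemma osup_upper:
  fixes S :: "'a::infinite ordinal set"
  assumes "(card_of S, card_of (UNIV :: 'a set)) \<in> ordLeq" and "x \<in> S"
  shows "x \<le> osup S"
proof -
  obtain u where "\<forall>x\<in>S. x \<le> u" using small_strictly_bounded[OF assms(1)] less_imp_le by blast
  then have "\<forall>x\<in>S. x \<le> osup S" unfolding osup_def by (rule LeastI)
  with assms(2) show ?thesis by blast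
qed

lemma osup_least: "(\<And>x. x \<in> S \<Longrightarrow> x \<le> u) \<Longrightarrow> osup S \<le> u"
  unfolding osup_def by (rule Least_le) blast

lemma countable_card_le:
  "(card_of (range (f :: nat \<Rightarrow> 'b)), card_of (UNIV :: 'a::infinite set)) \<in> ordLeq"
proof -
  have "(card_of (UNIV :: nat set), card_of (UNIV :: 'a set)) \<in> ordLeq"
    using infinite_UNIV[where 'a='a] by (rule infinite_iff_card_of_nat[THEN iffD1])
  with card_of_image[of f UNIV] show ?thesis by (rule ordLeq_transitive)
qed

lemma less_osuc: "(x :: 'a::infinite ordinal) < osuc x"
proof -
  obtain u where "x < u"
    using small_strictly_bounded[of "{x}"] card_of_singl_ordLeq[of "UNIV :: 'a set" x] by auto
  then show ?thesis unfolding osuc_def by (rule LeastI)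
qed

lemma osuc_le_iff: "osuc (x :: 'a::infinite ordinal) \<le> y \<longleftrightarrow> x < y"
proof
  show "osuc x \<le> y \<Longrightarrow> x < y" by (rule less_le_trans[OF less_osuc])
  show "x < y \<Longrightarrow> osuc x \<le> y" unfolding osuc_def by (rule Least_le)
qed

lemma osuc_inject: "osuc (x :: 'a::infinite ordinal) = osuc y \<longleftrightarrow> x = y"
proof
  assume eq: "osuc x = osuc y"
  have "\<not> x < y" using osuc_le_iff[of x y] less_osuc[of y] unfolding eq by (meson leD)
  moreover have "\<not> y < x" using osuc_le_iff[of y x] less_osuc[of x] unfolding eq by (meson leD)
  ultimately show "x = y" by (rule antisym_conv3[THEN iffD1, rotated])
qed (rule arg_cong)

lemma orec_0: "orec z s 0 = z"
  by (subst orec.simps) (rule if_P[OF refl])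

lemma orec_osuc: "orec z s (osuc (b :: 'a::infinite ordinal)) = s (orec z s b)"
proof -
  have "osuc b \<noteq> 0" using ordinal_zero_le[of b] less_osuc[of b] by (metis leD)
  moreover have ex: "\<exists>c<osuc b. osuc b = osuc c" using less_osuc by blast
  moreover have "(SOME c. c < osuc b \<and> osuc b = osuc c) = b"
    using someI_ex[OF ex] by (simp only: osuc_inject)
  ultimately show ?thesis by (subst orec.simps) (simp only: if_True if_False simp_thms)
qed

lemma orec_limit:
  assumes "b \<noteq> 0" and "\<And>c. b \<noteq> osuc c"
  shows "orec z s b = osup (orec z s ` {..<b})"
  using assms by (subst orec.simps) (simp only: lessThan_def if_False simp_thms)

lemma ordinal_add_1: "(x :: 'a::infinite ordinal) + 1 = osuc x"
  by (simp only: plus_ordinal_def one_ordinal_def orec_osuc orec_0)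

end

theory Submission
  imports Defs
begin

text \<open>
  The interpretation maps each operation on constructive ordinals to the corresponding operation
  on set-theoretic ordinals, because functions defined by transfinite recursion with an inflationary
  successor step commute with small nonempty suprema. Thus (i) says that \<open>\<omega>\<^sup>k\<close> is closed under
  addition. For (ii), an ordinal below \<open>\<omega>\<^sup>m\<^sup>+\<^sup>1\<close> lies below some \<open>\<omega>\<^sup>m \<cdot> n\<close>, and splitting off copies
  of \<open>\<omega>\<^sup>m\<close> from the left leaves a remainder below \<open>\<omega>\<^sup>m\<close>.
\<close>

section \<open>Recursion and suprema\<close>

lemma less_osuc_iff: "x < osuc y \<longleftrightarrow> x \<le> y" for x y :: "'a::infinite ordinal"
  by (metis osuc_le_iff not_le)

lemma ordinal_not_less_0 [simp]: "\<not> x < 0" for x :: "'a ordinal"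
  by (simp add: not_less)

lemma ordinal_le_0_iff [simp]: "x \<le> 0 \<longleftrightarrow> x = 0" for x :: "'a ordinal"
  by (metis antisym ordinal_zero_le order_refl)

lemma ordinal_cases [case_names zero osuc limit]:
  fixes b :: "'a::infinite ordinal"
  obtains "b = 0" | c where "b = osuc c" | "b \<noteq> 0" "\<And>c. b \<noteq> osuc c"
  by blast

lemma osuc_less_limit: "c < b \<Longrightarrow> (\<And>c. b \<noteq> osuc c) \<Longrightarrow> osuc c < b"
  for b :: "'a::infinite ordinal"
  by (metis osuc_le_iff le_less)

lemma less_osupE:
  assumes "u < osup S"
  obtains x where "x \<in> S" and "u < x"
proof (rule ccontr)
  note * = that
  assume "\<not> thesis"
  then have "x \<le> u" if "x \<in> S" for x using that * not_less by blast
  then have "osup S \<le> u" by (rule osup_least)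
  with assms show False by simp
qed

text \<open>This supplies the smallness that \<open>osup_upper\<close> demands for the suprema in
  limit clauses; a set too large could be unbounded.\<close>

lemma card_of_image_lessThan:
  "(card_of (f ` {..<b :: 'a ordinal}), card_of (UNIV :: 'a set)) \<in> ordLeq"
  by (rule ordLeq_transitive[OF card_of_image card_of_lessThan_ordinal])

text \<open>Inflationarity of \<open>s\<close> is what carries the inequality across successors. At
  a limit, the value at \<open>b\<close> is one of those whose supremum is taken.\<close>

lemma orec_mono:
  fixes z :: "'a::infinite ordinal"
  assumes "\<And>x. x \<le> s x" and "b \<le> c"
  shows "orec z s b \<le> orec z s c"
  using assms(2)
proof (induction c rule: less_induct)
  case (less c)
  show ?case
  proof (cases "b = c")
    case False
    with less.prems have "b < c" by simp
    show ?thesis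
    proof (cases c rule: ordinal_cases)
      case zero
      with \<open>b < c\<close> show ?thesis by (simp add: leD)
    next
      case (osuc d)
      with \<open>b < c\<close> have "b \<le> d" by (simp add: less_osuc_iff)
      then have "orec z s b \<le> orec z s d" using less.IH osuc less_osuc by blast
      also have "\<dots> \<le> orec z s c" unfolding osuc orec_osuc by (rule assms(1))
      finally show ?thesis .
    next
      case limit
      show ?thesis
        unfolding orec_limit[OF limit] using \<open>b < c\<close> by (intro osup_upper card_of_image_lessThan) simp
    qed
  qed simp
qed

text \<open>\<open>S\<close> need not consist of an increasing sequence, so \<open>osup S\<close>
  may be attained; otherwise it is a limit in which \<open>S\<close> is cofinal. For empty
  \<open>S\<close> the left side would be \<open>z\<close> but the right side 0.\<close>

lemma orec_osup:
  fixes z :: "'a::infinite ordinal"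
  assumes infl: "\<And>x. x \<le> s x" and "S \<noteq> {}"
    and small: "(card_of S, card_of (UNIV :: 'a set)) \<in> ordLeq"
  shows "orec z s (osup S) = osup (orec z s ` S)"
proof (rule antisym)
  have small': "(card_of (orec z s ` S), card_of (UNIV :: 'a set)) \<in> ordLeq"
    by (rule ordLeq_transitive[OF card_of_image small])
  show "osup (orec z s ` S) \<le> orec z s (osup S)"
    by (rule osup_least) (auto intro!: orec_mono infl osup_upper small)
  show "orec z s (osup S) \<le> osup (orec z s ` S)"
  proof (cases "osup S \<in> S")
    case True
    then show ?thesis by (intro osup_upper small') simp
  next
    case False
    then have lt: "x < osup S" if "x \<in> S" for x
      using osup_upper[OF small that] that by (auto simp: le_less)
    have nz: "osup S \<noteq> 0"
      using \<open>S \<noteq> {}\<close> lt by fastforce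
    \<comment> \<open>If the supremum were \<open>osuc c\<close> and not attained, \<open>c\<close>
      would already bound \<open>S\<close>.\<close>
    have ns: "osup S \<noteq> osuc c" for c
    proof
      assume eq: "osup S = osuc c"
      then have "osup S \<le> c" using lt by (intro osup_least) (simp add: less_osuc_iff)
      then show False using eq less_osuc[of c] by simp
    qed
    show ?thesis unfolding orec_limit[OF nz ns]
    proof (rule osup_least)
      fix y assume "y \<in> orec z s ` {..<osup S}"
      then obtain c where c: "c < osup S" "y = orec z s c" by auto
      then obtain x where "x \<in> S" "c < x" using less_osupE by blast
      then have "y \<le> orec z s x" unfolding c(2) by (intro orec_mono infl) simp
      also have "\<dots> \<le> osup (orec z s ` S)" using \<open>x \<in> S\<close> by (intro osup_upper small') simp
      finally show "y \<le> osup (orec z s ` S)" .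
    qed
  qed
qed

section \<open>Ordinal arithmetic\<close>

lemma ordinal_add_0 [simp]: "a + 0 = a" for a :: "'a::infinite ordinal"
  by (simp add: plus_ordinal_def orec_0)

lemma ordinal_add_osuc [simp]: "a + osuc b = osuc (a + b)" for a :: "'a::infinite ordinal"
  by (simp add: plus_ordinal_def orec_osuc)

lemma ordinal_add_limit:
  fixes a :: "'a::infinite ordinal"
  assumes "b \<noteq> 0" and "\<And>c. b \<noteq> osuc c"
  shows "a + b = osup ((+) a ` {..<b})"
  using orec_limit[OF assms] by (simp add: plus_ordinal_def)

lemma ordinal_add_osup:
  fixes a :: "'a::infinite ordinal"
  assumes "S \<noteq> {}" and "(card_of S, card_of (UNIV :: 'a set)) \<in> ordLeq"
  shows "a + osup S = osup ((+) a ` S)"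
  unfolding plus_ordinal_def using assms by (intro orec_osup) (simp_all add: less_osuc less_imp_le)

lemma ordinal_add_right_mono: "b \<le> c \<Longrightarrow> a + b \<le> a + c" for a :: "'a::infinite ordinal"
  unfolding plus_ordinal_def by (intro orec_mono) (simp_all add: less_osuc less_imp_le)

lemma ordinal_add_right_strict_mono: "a + b < a + c" if "b < c" for a :: "'a::infinite ordinal"
proof -
  have "a + b < a + osuc b" by (simp add: less_osuc)
  also have "\<dots> \<le> a + c" using that by (intro ordinal_add_right_mono) (simp add: osuc_le_iff)
  finally show ?thesis .
qed

text \<open>Only the weak form is available: 0 + omega = 1 + omega.\<close>

lemma ordinal_add_left_mono: "a \<le> b \<Longrightarrow> a + c \<le> b + c" for a :: "'a::infinite ordinal"
proof (induction c rule: less_induct)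
  case (less c)
  show ?case
  proof (cases c rule: ordinal_cases)
    case (osuc d)
    then show ?thesis using less by (simp add: less_osuc osuc_le_iff less_osuc_iff)
  next
    case limit
    show ?thesis unfolding ordinal_add_limit[OF limit, of a]
    proof (rule osup_least)
      fix x assume "x \<in> (+) a ` {..<c}"
      then obtain d where d: "d < c" "x = a + d" by auto
      then have "x \<le> b + d" using less by simp
      also have "\<dots> \<le> b + c" using d by (intro ordinal_add_right_mono) simp
      finally show "x \<le> b + c" .
    qed
  qed (use less in simp)
qed

lemma osup_lessThan_limit:
  fixes b :: "'a::infinite ordinal"
  assumes "\<And>c. b \<noteq> osuc c"
  shows "osup {..<b} = b"
proof (rule antisym)
  show "osup {..<b} \<le> b" by (rule osup_least) simp
  show "b \<le> osup {..<b}"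
  proof (rule ccontr)
    assume "\<not> b \<le> osup {..<b}"
    then have "osuc (osup {..<b}) < b" using assms by (intro osuc_less_limit) auto
    then have "osuc (osup {..<b}) \<le> osup {..<b}"
      by (intro osup_upper card_of_lessThan_ordinal) simp
    then show False by (simp add: osuc_le_iff)
  qed
qed

lemma ordinal_0_add [simp]: "0 + b = b" for b :: "'a::infinite ordinal"
proof (induction b rule: less_induct)
  case (less b)
  show ?case
  proof (cases b rule: ordinal_cases)
    case (osuc d)
    then show ?thesis using less by (simp add: less_osuc)
  next
    case limit
    have "(+) 0 ` {..<b} = {..<b}" using less by force
    then show ?thesis
      unfolding ordinal_add_limit[OF limit] by (simp add: osup_lessThan_limit[OF limit(2)])
  qed simp
qed

lemma ordinal_add_assoc: "(a + b) + c = a + (b + c)" for a :: "'a::infinite ordinal"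
proof (induction c rule: less_induct)
  case (less c)
  show ?case
  proof (cases c rule: ordinal_cases)
    case (osuc d)
    then show ?thesis using less by (simp add: less_osuc)
  next
    case limit
    have "0 < c" using limit(1) ordinal_le_0_iff not_le by blast
    \<comment> \<open>Commuting \<open>a +\<close> with the supremum avoids having to show that
      \<open>b + c\<close> is itself a limit.\<close>
    then have "a + (b + c) = osup ((+) a ` (+) b ` {..<c})"
      unfolding ordinal_add_limit[OF limit, of b]
      by (intro ordinal_add_osup card_of_image_lessThan) auto
    also have "(+) a ` (+) b ` {..<c} = (+) (a + b) ` {..<c}"
      unfolding image_image using less by (intro image_cong) auto
    also have "osup \<dots> = (a + b) + c" by (rule ordinal_add_limit[OF limit, symmetric])
    finally show ?thesis ..
  qed simp
qed

lemma ordinal_le_imp_add: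
  fixes a b :: "'a::infinite ordinal"
  assumes "a \<le> b"
  obtains c where "b = a + c"
proof -
  \<comment> \<open>Left subtraction. Minimality gives \<open>a + d < b\<close> for all
    \<open>d < c\<close>, and the recursion clause for \<open>a + c\<close> turns this into
    \<open>a + c \<le> b\<close>.\<close>
  define c where "c = (LEAST c. b \<le> a + c)"
  have "b \<le> a + b" using ordinal_add_left_mono[of 0 a b] by simp
  then have ge: "b \<le> a + c" unfolding c_def by (rule LeastI)
  have lt: "a + d < b" if "d < c" for d
    using not_less_Least[of d "\<lambda>c. b \<le> a + c"] that unfolding c_def by simp
  have "a + c \<le> b"
  proof (cases c rule: ordinal_cases)
    case zero
    then show ?thesis using assms by simp
  next
    case (osuc d)
    then show ?thesis using lt[of d] by (simp add: less_osuc osuc_le_iff)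
  next
    case limit
    show ?thesis unfolding ordinal_add_limit[OF limit]
      by (rule osup_least) (use lt less_imp_le in blast)
  qed
  with ge show ?thesis by (intro that[of c] antisym)
qed

section \<open>Multiplication\<close>

lemma ordinal_mult_0 [simp]: "a * 0 = 0" for a :: "'a::infinite ordinal"
  by (simp add: times_ordinal_def orec_0)

lemma ordinal_mult_osuc [simp]: "a * osuc b = a * b + a" for a :: "'a::infinite ordinal"
  by (simp add: times_ordinal_def orec_osuc)

text \<open>This makes the successor step of the recursion for \<open>a * b\<close>
  inflationary.\<close>

lemma ordinal_le_add: "x \<le> x + a" for a :: "'a::infinite ordinal"
  using ordinal_add_right_mono[of 0 a x] by simp

lemma ordinal_mult_osup:
  fixes a :: "'a::infinite ordinal"
  assumes "S \<noteq> {}" and "(card_of S, card_of (UNIV :: 'a set)) \<in> ordLeq"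
  shows "a * osup S = osup ((*) a ` S)"
  unfolding times_ordinal_def using assms by (intro orec_osup ordinal_le_add) simp_all

lemma ordinal_mult_right_mono: "b \<le> c \<Longrightarrow> a * b \<le> a * c" for a :: "'a::infinite ordinal"
  unfolding times_ordinal_def by (intro orec_mono ordinal_le_add)

section \<open>Finite ordinals and powers of omega\<close>

declare ordinal_add_1 [simp]

lemma fin_ord_strict_mono: "m < n \<Longrightarrow> (fin_ord m :: 'a::infinite ordinal) < fin_ord n"
  by (rule lift_Suc_mono_less[of "fin_ord :: nat \<Rightarrow> 'a ordinal"]) (simp_all add: less_osuc)

lemma finite_lessThan_fin_ord: "finite {..<fin_ord n :: 'a::infinite ordinal}"
proof (induction n)
  case 0
  have "{..<0 :: 'a ordinal} = {}" by auto
  then show ?case by simp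
next
  case (Suc n)
  have "{..<fin_ord (Suc n) :: 'a ordinal} = insert (fin_ord n) {..<fin_ord n}"
    by (auto simp: less_osuc_iff)
  then show ?case using Suc by simp
qed

text \<open>This brings the least infinite ordinal into the shape of the sequence in
  \<open>omega_cord\<close>. Every ordinal below the supremum lies below some finite one, so it has
  only finitely many predecessors.\<close>

lemma omega_ord_eq: "(omega_ord :: 'a::infinite ordinal) = osup (range (\<lambda>i. fin_ord (Suc i)))"
proof -
  define w where "w = osup (range (\<lambda>i. fin_ord (Suc i) :: 'a ordinal))"
  have le: "fin_ord (Suc i) \<le> w" for i
    unfolding w_def by (intro osup_upper countable_card_le) simp
  have "fin_ord i < w" for i
    using fin_ord_strict_mono[of i "Suc i"] le[of i] by (rule less_le_trans) simp
  then have "range fin_ord \<subseteq> {..<w}" by auto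
  moreover have "inj (fin_ord :: nat \<Rightarrow> 'a ordinal)"
    by (intro linorder_injI) (metis fin_ord_strict_mono less_irrefl)
  ultimately have inf: "infinite {..<w}" using finite_subset finite_imageD infinite_UNIV_nat by blast
  have "w \<le> x" if "infinite {..<x}" for x
  proof (rule ccontr)
    assume "\<not> w \<le> x"
    then have "x < w" by simp
    then obtain i where "x < fin_ord (Suc i)" unfolding w_def by (rule less_osupE) blast
    then have "{..<x} \<subseteq> {..<fin_ord (Suc i)}" by auto
    with that show False using finite_lessThan_fin_ord finite_subset by blast
  qed
  with inf show ?thesis unfolding omega_ord_def w_def[symmetric] by (intro Least_equality)
qed

lemma ordinal_mult_omega:
  "a * omega_ord = osup (range (\<lambda>i. a * fin_ord (Suc i)))" for a :: "'a::infinite ordinal"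
  unfolding omega_ord_eq
  by (subst ordinal_mult_osup) (simp_all add: countable_card_le image_image del: fin_ord.simps)

lemma less_mult_omegaE:
  fixes a b :: "'a::infinite ordinal"
  assumes "b < a * omega_ord"
  obtains n where "b < a * fin_ord n"
  using assms unfolding ordinal_mult_omega by (rule less_osupE) (blast intro: that)

lemma ordinal_mult_fin_ord_add:
  "a * fin_ord m + a * fin_ord n = a * fin_ord (m + n)" for a :: "'a::infinite ordinal"
  by (induction n) (simp_all add: ordinal_add_assoc[symmetric])

lemma mult_fin_ord_le_mult_omega: "a * fin_ord n \<le> a * omega_ord" for a :: "'a::infinite ordinal"
proof -
  \<comment> \<open>The sequence for omega starts at 1, so n = 0 is not among its indices; passing
    to n + 1 covers all n.\<close>
  have "a * fin_ord n \<le> a * fin_ord (Suc n)"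
    by (intro ordinal_mult_right_mono) (simp add: less_osuc less_imp_le)
  also have "\<dots> \<le> a * omega_ord"
    unfolding ordinal_mult_omega by (intro osup_upper countable_card_le) simp
  finally show ?thesis .
qed

lemma less_mult_omega: "a < a * omega_ord" if "0 < a" for a :: "'a::infinite ordinal"
proof -
  have "a < a * fin_ord 2"
    using ordinal_add_right_strict_mono[OF that, of a] by (simp add: numeral_2_eq_2)
  then show ?thesis using mult_fin_ord_le_mult_omega by (rule less_le_trans)
qed

section \<open>Finite powers of omega\<close>

abbreviation (input) omega_power :: "nat \<Rightarrow> 'a::infinite ordinal" where
  "omega_power n \<equiv> omega_ord ^o fin_ord n"

lemma omega_power_0 [simp]: "omega_ord ^o 0 = osuc 0"
  by (simp add: opow_def orec_0 one_ordinal_def)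

lemma omega_power_Suc: "omega_power (Suc n) = omega_power n * omega_ord"
  by (simp add: opow_def orec_osuc)

lemma omega_power_pos: "(0 :: 'a::infinite ordinal) < omega_power n"
proof (induction n)
  case 0
  show ?case by (simp add: less_osuc)
next
  case (Suc n)
  then show ?case using less_mult_omega[OF Suc] less_trans unfolding omega_power_Suc by blast
qed

lemma omega_power_strict_mono: "m < n \<Longrightarrow> (omega_power m :: 'a::infinite ordinal) < omega_power n"
proof (rule lift_Suc_mono_less[of "omega_power :: nat \<Rightarrow> 'a ordinal"])
  show "(omega_power n :: 'a ordinal) < omega_power (Suc n)" for n
    unfolding omega_power_Suc by (intro less_mult_omega omega_power_pos)
qed

text \<open>Both summands lie below finite multiples of omega^m, where k = m + 1, so their sum lies
  below another finite multiple. For k = 0 both are 0.\<close>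

lemma omega_power_add_closed:
  fixes a b :: "'a::infinite ordinal"
  assumes "a < omega_power k" and "b < omega_power k"
  shows "a + b < omega_power k"
proof (cases k)
  case 0
  then have "a = 0" "b = 0" using assms by (simp_all add: less_osuc_iff)
  then show ?thesis using omega_power_pos by simp
next
  case (Suc m)
  obtain n where n: "a < omega_power m * fin_ord n"
    using assms(1) unfolding Suc omega_power_Suc by (rule less_mult_omegaE)
  obtain n' where n': "b < omega_power m * fin_ord n'"
    using assms(2) unfolding Suc omega_power_Suc by (rule less_mult_omegaE)
  \<comment> \<open>Strictness has to come from the right summand, since enlarging the left one only
    gives a weak inequality.\<close>
  have "a + b \<le> omega_power m * fin_ord n + b" using n by (intro ordinal_add_left_mono) simp
  also have "\<dots> < omega_power m * fin_ord n + omega_power m * fin_ord n'"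
    using n' by (rule ordinal_add_right_strict_mono)
  also have "\<dots> \<le> omega_power k"
    unfolding ordinal_mult_fin_ord_add Suc omega_power_Suc by (rule mult_fin_ord_le_mult_omega)
  finally show ?thesis .
qed

section \<open>The interpretation\<close>

lemma sem_cadd: "(sem (cadd a b) :: 'a::infinite ordinal) = sem a + sem b"
proof (induction b)
  case (Lim f)
  then show ?case by (simp add: ordinal_add_osup countable_card_le image_image)
qed simp_all

lemma sem_cmul: "(sem (cmul a b) :: 'a::infinite ordinal) = sem a * sem b"
proof (induction b)
  case (Lim f)
  then show ?case by (simp add: ordinal_mult_osup countable_card_le image_image)
qed (simp_all add: sem_cadd)

lemma sem_fin_cord: "sem (fin_cord n) = fin_ord n"
  by (induction n) simp_all

lemma sem_omega_cord: "sem omega_cord = omega_ord"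
  by (simp add: omega_cord_def omega_ord_eq sem_fin_cord)

text \<open>Each step on the exponent is the product law. Such a law fails for arbitrary bases and
  exponents: multiplication by 0 is not inflationary, so \<open>orec_osup\<close> does not
  apply.\<close>

lemma sem_omega_power: "sem (cpow omega_cord (fin_cord p)) = omega_power p"
proof (induction p)
  case 0
  show ?case by simp
next
  case (Suc p)
  then show ?case by (simp add: sem_cmul sem_omega_cord omega_power_Suc del: fin_ord.simps)
qed

section \<open>Values of the terms in \<open>Psi\<close>\<close>

lemma Psi_mono: "k \<le> l \<Longrightarrow> Psi k \<subseteq> Psi l"
proof
  fix a assume "a \<in> Psi k" and "k \<le> l"
  then show "a \<in> Psi l" by induction (auto intro: Psi.intros)
qed

lemma sem_Psi_less: "\<alpha> \<in> Psi k \<Longrightarrow> (sem \<alpha> :: 'a::infinite ordinal) < omega_power k"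
proof (induction rule: Psi.induct)
  case zero
  show ?case using omega_power_pos by simp
next
  case (power p)
  then show ?case using omega_power_strict_mono sem_omega_power by metis
next
  case (add a b)
  then show ?case by (simp add: sem_cadd omega_power_add_closed)
qed

text \<open>These are the leading blocks of an ordinal below omega^(m+1); omega^m is a generator of
  \<open>Psi (Suc m)\<close> but not of \<open>Psi m\<close>.\<close>

lemma sem_Psi_multiple:
  "\<exists>\<alpha>\<in>Psi (Suc m). sem \<alpha> = (omega_power m * fin_ord n :: 'a::infinite ordinal)"
proof (induction n)
  case 0
  show ?case using Psi.zero by (intro bexI[of _ Zero]) simp_all
next
  case (Suc n)
  then obtain \<alpha> where "\<alpha> \<in> Psi (Suc m)" "sem \<alpha> = (omega_power m * fin_ord n :: 'a ordinal)" by blast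
  then show ?case
    by (intro bexI[of _ "cadd \<alpha> (cpow omega_cord (fin_cord m))"])
      (simp_all add: sem_cadd sem_omega_power Psi.add Psi.power)
qed

lemma sem_Psi_surj: "\<beta> < omega_power k \<Longrightarrow> \<exists>\<alpha>\<in>Psi k. sem \<alpha> = \<beta>"
  for \<beta> :: "'a::infinite ordinal"
proof (induction k arbitrary: \<beta>)
  case 0
  then have "\<beta> = 0" by (simp add: less_osuc_iff)
  then show ?case using Psi.zero by (intro bexI[of _ Zero]) simp_all
next
  case (Suc m)
  obtain n where "\<beta> < omega_power m * fin_ord n"
    using Suc.prems unfolding omega_power_Suc by (rule less_mult_omegaE)
  \<comment> \<open>The inner induction finds the number of blocks omega^m that fit into
    \<open>\<beta>\<close>.\<close>
  then show ?case
  proof (induction n)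
    case 0
    then show ?case by (simp add: leD)
  next
    case (Suc n)
    show ?case
    proof (cases "\<beta> < omega_power m * fin_ord n")
      case False
      then have "omega_power m * fin_ord n \<le> \<beta>" by simp
      then obtain \<gamma> where \<gamma>: "\<beta> = omega_power m * fin_ord n + \<gamma>" by (rule ordinal_le_imp_add)
      \<comment> \<open>A remainder of at least omega^m would allow one more block, against the
        bound with n + 1 blocks.\<close>
      have "\<gamma> < omega_power m"
      proof (rule ccontr)
        assume "\<not> \<gamma> < omega_power m"
        then have "omega_power m * fin_ord n + omega_power m \<le> \<beta>"
          unfolding \<gamma> by (intro ordinal_add_right_mono) simp
        with Suc.prems show False by simp
      qed
      \<comment> \<open>The quoted fact is the induction hypothesis on the exponent;
        \<open>Suc.IH\<close> now refers to the number of blocks.\<close>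
      then obtain \<delta> where \<delta>: "\<delta> \<in> Psi (Suc m)" "sem \<delta> = \<gamma>"
        using \<open>\<And>\<beta>. \<beta> < omega_power m \<Longrightarrow> \<exists>\<alpha>\<in>Psi m. sem \<alpha> = \<beta>\<close> Psi_mono[of m "Suc m"]
        by fastforce
      obtain \<alpha> where "\<alpha> \<in> Psi (Suc m)" "sem \<alpha> = (omega_power m * fin_ord n :: 'a ordinal)"
        using sem_Psi_multiple by blast
      with \<delta> \<gamma> show ?thesis
        by (intro bexI[of _ "cadd \<alpha> \<delta>"]) (simp_all add: sem_cadd Psi.add)
    qed (use Suc.IH in blast)
  qed
qed

theorem theorem6p13:
  fixes k :: nat
  assumes "k \<ge> 1"
  shows "(\<forall>\<alpha>\<in>Psi k. (sem \<alpha> :: 'a::infinite ordinal) < omega_ord ^o fin_ord k) \<and>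
         (\<forall>\<beta> :: 'a::infinite ordinal. \<beta> < omega_ord ^o fin_ord k \<longrightarrow> (\<exists>\<alpha>\<in>Psi k. sem \<alpha> = \<beta>))"
  using sem_Psi_less sem_Psi_surj by blast

end
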